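(* Let $u\ge 2$ be an integer. For $1\le n\le 2u-1$, we have $|\mathcal{D}_{u,n}| = F_n$. For $n\ge 2u$, $$|\mathcal{D}_{u,n}| = \sum_{i=1}^{u}(-1)^{i-1}\binom{u}{i}|\mathcal{D}_{u,n-i}| + |\mathcal{D}_{u,n-2u+1}|.$$
   Context: $(F_n)_{n\ge 1}$ is the Fibonacci sequence: $F_1=F_2=1$ and $F_n=F_{n-1}+F_{n-2}$ for $n\ge 3$. A finite nonempty set $F$ of positive integers is Schreier if $\min F\ge |F|$. For an integer $u\ge 2$ and a positive integer $n$, let $G_{u,n}$ be the set of the first $n$ positive integers that are not divisible by $u$; its largest element is $\left\lfloor \frac{un-1}{u-1}\right\rfloor$. Define $$\mathcal{D}_{u,n} := \left\{F\subset G_{u,n} : \left\lfloor\frac{un-1}{u-1}\right\rfloor\in F \text{ and } F \text{ is Schreier}\right\}.$$ *)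

theory Defs
  imports "HOL-Number_Theory.Fib" "HOL-Library.Infinite_Set"
begin

definition schreier :: "nat set \<Rightarrow> bool" where
  "schreier F \<longleftrightarrow> finite F \<and> F \<noteq> {} \<and> (\<forall>x\<in>F. 0 < x) \<and> card F \<le> Min F"

(* enumerate S k is the element with index k, counted from 0, of the infinite set S in
   increasing order.  The set below is infinite for u = 0 and for u \<ge> 2; for u = 1 it is
   empty, so G 1 n carries no meaning. *)
definition G :: "nat \<Rightarrow> nat \<Rightarrow> nat set" where
  "G u n = enumerate {m. 0 < m \<and> \<not> u dvd m} ` {..<n}"

(* For u \<ge> 2 and n \<ge> 1 neither subtraction truncates, and div is the floor of the quotient. *)
definition D :: "nat \<Rightarrow> nat \<Rightarrow> nat set set" where
  "D u n = {F. F \<subseteq> G u n \<and> (u * n - 1) div (u - 1) \<in> F \<and> schreier F}"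

end

theory Submission
  imports Defs "HOL-Computational_Algebra.Formal_Power_Series"
begin

text \<open>
  Write \<open>d = u - 1\<close> and number the positive integers not divisible by \<open>u\<close> from zero as
  \<open>e 0 < e 1 < \<dots>\<close>; then \<open>e k = k + 1 + k div d\<close>, so that \<open>e (k + d) = e k + u\<close>.  A Schreier set
  with minimum \<open>e k\<close>, maximum \<open>e m\<close> and \<open>j + 1\<close> elements is a way to climb from index \<open>k\<close> to
  index \<open>m\<close> in \<open>j < e k\<close> positive steps.  One step has the generating function
  \<open>Q = X / (1 - X)\<close>, hence the number of all sets with maximum \<open>e m\<close> is the coefficient of
  \<open>X ^ m\<close> in the sum over \<open>k\<close> of \<open>X ^ k * (1 + Q + \<dots> + Q ^ (e k - 1))\<close>
  (lemma \<open>card_D_eq_nth_gf\<close>).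

  For \<open>m \<le> 2 * d\<close> the coefficient does not change if \<open>e k\<close> is replaced by \<open>k + 1\<close>: the two differ
  only for \<open>k \<ge> d\<close>, and then \<open>X ^ k * Q ^ j\<close> with \<open>j > k\<close> starts beyond \<open>X ^ (2 * d)\<close>.  For the
  bound \<open>k + 1\<close> the series is \<open>1 / ((1 - X) * (1 - X * Q)) = 1 / (1 - X - X ^ 2)\<close>, the Fibonacci
  series.

  For the recurrence, multiply the series by \<open>(1 - X) ^ u\<close>, which forms the alternating binomial
  sum of the counts.  Since \<open>(1 - X) ^ u * Q ^ u = X ^ u\<close> and \<open>e (k + d) = e k + u\<close>, the summands
  with index \<open>k + d\<close> and exponent \<open>j + u\<close> reproduce the series itself, multiplied by
  \<open>X ^ d * X ^ u = X ^ (2 * u - 1)\<close>.  What is left over is a polynomial of degree at most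
  \<open>2 * u - 2\<close>: the summands with \<open>k < d\<close> give polynomials of degree at most \<open>k + u\<close>, and for the
  other \<open>k\<close> the exponents below \<open>u\<close> leave \<open>(1 - X) * P\<close> with the same polynomial \<open>P\<close> of
  degree at most \<open>d\<close>, so that the geometric sum over these \<open>k\<close> cancels the factor \<open>1 - X\<close> and leaves
  \<open>X ^ d * P\<close>.  This is lemma \<open>gf_nondiv_functional_equation\<close>, in a version truncated to finitely
  many \<open>k\<close>.
\<close>

unbundle fps_syntax

section \<open>Enumerating the integers not divisible by u\<close>

lemma enumerate_range_strict_mono:
  fixes f :: "nat \<Rightarrow> nat"
  assumes f: "strict_mono f"
  shows "enumerate (range f) n = f n"
proof (induction n)
  case 0
  have "(LEAST s. s \<in> range f) = f 0"
    using f by (intro Least_equality) (auto simp: strict_mono_less_eq)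
  then show ?case by (simp add: enumerate_0)
next
  case (Suc n)
  have "infinite (range f)"
    using f by (simp add: finite_image_iff strict_mono_imp_inj_on)
  then have "enumerate (range f) (Suc n) = (LEAST s. s \<in> range f \<and> f n < s)"
    using Suc by (simp add: enumerate_Suc'')
  also have "\<dots> = f (Suc n)"
    using f by (intro Least_equality) (auto simp: strict_mono_less_eq strict_mono_less Suc_le_eq)
  finally show ?case .
qed

text \<open>The parameter is \<open>d = u - 1\<close>, so that no truncated subtraction occurs below.\<close>

definition nondiv :: "nat \<Rightarrow> nat \<Rightarrow> nat" where
  "nondiv d k = k + 1 + k div d"

lemma strict_mono_nondiv: "strict_mono (nondiv d)"
proof -
  have "k div d \<le> Suc k div d" for k by (rule div_le_mono) simp
  then show ?thesis unfolding strict_mono_Suc_iff nondiv_def by (simp add: less_Suc_eq_le)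
qed

text \<open>Writing \<open>k = q * d + r\<close> with \<open>r < d\<close> turns \<open>nondiv d k\<close> into \<open>q * (d + 1) + (r + 1)\<close>: each block of
  \<open>d\<close> indices fills the nonzero residues modulo \<open>d + 1\<close>.\<close>

lemma range_nondiv:
  assumes "d \<ge> 1"
  shows "range (nondiv d) = {m. 0 < m \<and> \<not> Suc d dvd m}"
proof (intro equalityI subsetI)
  fix m assume "m \<in> range (nondiv d)"
  then obtain k where k: "m = nondiv d k" by blast
  have "m = Suc d * (k div d) + (k mod d + 1)"
    unfolding k nondiv_def by (simp add: algebra_simps)
  moreover have "k mod d + 1 < Suc d" using assms by simp
  ultimately have "m mod Suc d = k mod d + 1"
    by (metis mod_less mod_mult_self4)
  then show "m \<in> {m. 0 < m \<and> \<not> Suc d dvd m}"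
    using k by (auto simp: nondiv_def mod_0_imp_dvd dvd_eq_mod_eq_0)
next
  fix m assume "m \<in> {m. 0 < m \<and> \<not> Suc d dvd m}"
  then have m: "m mod Suc d \<noteq> 0" by (simp add: dvd_eq_mod_eq_0)
  define k where "k = d * (m div Suc d) + (m mod Suc d - 1)"
  have "m mod Suc d < Suc d" by (rule mod_less_divisor) simp
  then have r: "m mod Suc d - 1 < d" using m by linarith
  then have "k div d = m div Suc d" using assms unfolding k_def by simp
  then have "nondiv d k = d * (m div Suc d) + (m mod Suc d - 1) + 1 + m div Suc d"
    by (simp add: nondiv_def k_def)
  also have "\<dots> = Suc d * (m div Suc d) + m mod Suc d" using m by simp
  also have "\<dots> = m" by (rule mult_div_mod_eq)
  finally show "m \<in> range (nondiv d)" by (metis rangeI)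
qed

text \<open>The quasi-periodicity that makes the generating function reproduce itself.\<close>

lemma nondiv_shift: "d \<ge> 1 \<Longrightarrow> nondiv d (k + d) = nondiv d k + Suc d"
  by (simp add: nondiv_def)

lemma nondiv_floor:
  assumes "d \<ge> 1"
  shows "(Suc d * Suc k - 1) div d = nondiv d k"
proof -
  have "Suc d * Suc k - 1 = (k + 1) * d + k" by simp
  then show ?thesis using assms by (simp add: nondiv_def)
qed

section \<open>Counting Schreier sets by generating functions\<close>

text \<open>\<open>Q = X / (1 - X)\<close> counts one positive step, so \<open>Q ^ j\<close> counts the compositions into \<open>j\<close> positive
  parts.  The coefficient form keeps everything over the integers.\<close>

definition Q :: "int fps" where
  "Q = Abs_fps (\<lambda>n. if n = 0 then 0 else 1)"

lemma one_minus_X_mult_Q: "(1 - fps_X) * Q = fps_X"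
proof (rule fps_ext)
  fix n show "((1 - fps_X) * Q) $ n = fps_X $ n"
    by (cases n) (auto simp: Q_def left_diff_distrib)
qed

lemma Q_power_cancel: "(1 - fps_X) ^ j * Q ^ j = fps_X ^ j"
  by (metis one_minus_X_mult_Q power_mult_distrib)

text \<open>Multiplying \<open>Q ^ (j + 1)\<close> by \<open>1 - X\<close> gives \<open>X * Q ^ j\<close>; read off coefficientwise, this is Pascal's
  rule.\<close>

lemma nth_Q_power_Suc: "(Q ^ Suc j) $ m = (if m = 0 then 0 else int ((m - 1) choose j))"
proof -
  have rec: "(Q ^ Suc i) $ Suc n = (Q ^ Suc i) $ n + (Q ^ i) $ n" for i n
  proof -
    have "((1 - fps_X) * Q ^ Suc i) $ Suc n = (fps_X * Q ^ i) $ Suc n"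
      by (metis one_minus_X_mult_Q mult.assoc power_Suc)
    then show ?thesis by (simp add: left_diff_distrib del: power_Suc)
  qed
  have zero: "(Q ^ Suc i) $ 0 = 0" for i by (simp add: Q_def)
  show ?thesis
  proof (induction m arbitrary: j)
    case 0
    show ?case using zero by (simp del: power_Suc)
  next
    case (Suc m)
    show ?case
    proof (cases "m = 0")
      case True
      then show ?thesis
        using rec[of j 0] zero[of 0] by (cases j) (simp_all add: zero del: power_Suc)
    next
      case False
      then obtain l where l: "m = Suc l" by (cases m) auto
      show ?thesis
        using rec[of j m] Suc[of j] Suc[of "j - 1"] by (cases j) (simp_all add: l del: power_Suc)
    qed
  qed
qed

lemma nth_X_mult_Q_power_eq_0:
  assumes "i < k + j"
  shows "(fps_X ^ k * Q ^ j) $ i = 0"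
proof (cases j)
  case 0
  then show ?thesis using assms by (simp add: fps_X_power_mult_nth)
next
  case (Suc l)
  then show ?thesis using assms by (auto simp: fps_X_power_mult_nth nth_Q_power_Suc simp del: power_Suc)
qed

text \<open>The \<open>j\<close> gaps between consecutive elements form a composition of \<open>m - k\<close> into \<open>j\<close> positive parts.  The
  proof counts the inner elements instead; the case \<open>k = m\<close>, where the two ends coincide, is the
  constant term of \<open>Q ^ j\<close>.\<close>

lemma card_subsets_with_ends:
  fixes k m :: nat
  assumes "k \<le> m"
  shows "int (card {A. A \<subseteq> {k..m} \<and> k \<in> A \<and> m \<in> A \<and> card A = Suc j}) = (Q ^ j) $ (m - k)"
    (is "int (card ?S) = _")
proof (cases "k = m")
  case True
  have "?S = (if j = 0 then {{k}} else {})"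
  proof -
    have "A \<in> ?S \<longleftrightarrow> A = {k} \<and> j = 0" for A
    proof (cases "A = {k}")
      case False
      then have "\<not> (A \<subseteq> {k..m} \<and> k \<in> A)" using \<open>k = m\<close> by auto
      then show ?thesis using False by blast
    qed (use \<open>k = m\<close> in simp)
    then show ?thesis by (intro set_eqI) simp
  qed
  then show ?thesis using True by (cases j) (simp_all add: nth_Q_power_Suc del: power_Suc)
next
  case False
  then have km: "k < m" using assms by simp
  show ?thesis
  proof (cases j)
    case 0
    have "?S = {}"
    proof -
      have "card A \<noteq> Suc 0" if "k \<in> A" "m \<in> A" for A
        using that km by (auto elim!: card_1_singletonE simp flip: One_nat_def)
      then show ?thesis using 0 by auto
    qed
    then have "card ?S = 0" by (metis card.empty)
    then show ?thesis using 0 km by simp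
  next
    case (Suc i)
    let ?T = "{B. B \<subseteq> {k<..<m} \<and> card B = i}"
    have "bij_betw (\<lambda>B. insert k (insert m B)) ?T ?S"
    proof (rule bij_betwI[where g = "\<lambda>A. A - {k, m}"])
      show "(\<lambda>B. insert k (insert m B)) \<in> ?T \<rightarrow> ?S"
      proof (intro funcsetI CollectI)
        fix B assume "B \<in> ?T"
        then have B: "B \<subseteq> {k<..<m}" "card B = i" by auto
        then have "finite B" "k \<notin> B" "m \<notin> B" by (auto intro: finite_subset)
        then show "insert k (insert m B) \<subseteq> {k..m} \<and> k \<in> insert k (insert m B) \<and>
            m \<in> insert k (insert m B) \<and> card (insert k (insert m B)) = Suc j"
          using B km Suc by auto
      qed
      show "(\<lambda>A. A - {k, m}) \<in> ?S \<rightarrow> ?T"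
      proof (intro funcsetI CollectI conjI)
        fix A assume A: "A \<in> ?S"
        have "x \<in> {k<..<m}" if "x \<in> A - {k, m}" for x
        proof -
          have "x \<in> {k..m}" "x \<noteq> k" "x \<noteq> m" using that A by auto
          then show ?thesis by simp
        qed
        then show "A - {k, m} \<subseteq> {k<..<m}" by blast
        have "card (A - {k, m}) = card A - card {k, m}"
          using A by (intro card_Diff_subset) auto
        then show "card (A - {k, m}) = i" using A km Suc by simp
      qed
    qed auto
    then have "card ?S = card ?T" by (simp add: bij_betw_same_card)
    also have "\<dots> = (m - k - 1) choose i"
      using n_subsets[of "{k<..<m}" i] by simp
    finally show ?thesis using km Suc by (simp add: nth_Q_power_Suc del: power_Suc)
  qed
qed

text \<open>The generating function of the finite index sets \<open>A\<close> with \<open>card A \<le> b (Min A)\<close>, sorted by their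
  maximum.  The sum is cut off at \<open>Min A < N\<close>, which leaves the coefficients below \<open>X ^ N\<close> exact and
  avoids infinite sums of power series.\<close>

definition gf :: "(nat \<Rightarrow> nat) \<Rightarrow> nat \<Rightarrow> int fps" where
  "gf b N = (\<Sum>k<N. fps_X ^ k * (\<Sum>j<b k. Q ^ j))"

lemma nth_gf:
  assumes "m < N"
  shows "gf b N $ m = (\<Sum>k\<le>m. \<Sum>j<b k. (Q ^ j) $ (m - k))"
proof -
  have "gf b N $ m = (\<Sum>k<N. if k \<le> m then \<Sum>j<b k. (Q ^ j) $ (m - k) else 0)"
    unfolding gf_def fps_sum_nth fps_X_power_mult_nth by (intro sum.cong) auto
  also have "\<dots> = (\<Sum>k\<in>{k\<in>{..<N}. k \<le> m}. \<Sum>j<b k. (Q ^ j) $ (m - k))"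
    by (rule sum.inter_filter[symmetric]) simp
  also have "{k\<in>{..<N}. k \<le> m} = {..m}" using assms by auto
  finally show ?thesis .
qed

text \<open>Sorting the sets by their minimum \<open>k\<close> and by \<open>j = card A - 1\<close> gives disjoint classes, each counted
  by a coefficient of \<open>Q ^ j\<close>.\<close>

lemma card_index_sets_eq_nth_gf:
  assumes "m < N"
  shows "int (card {A. A \<subseteq> {..m} \<and> m \<in> A \<and> card A \<le> b (Min A)}) = gf b N $ m"
proof -
  let ?S = "\<lambda>(k, j). {A. A \<subseteq> {k..m} \<and> k \<in> A \<and> m \<in> A \<and> card A = Suc j}"
  let ?I = "SIGMA k:{..m}. {..<b k}"
  have Min_eq: "Min A = k" if "A \<subseteq> {k..m}" "k \<in> A" for A k
    using that by (intro Min_eqI) (auto intro: finite_subset)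
  have "{A. A \<subseteq> {..m} \<and> m \<in> A \<and> card A \<le> b (Min A)} = (\<Union>p\<in>?I. ?S p)" (is "?L = ?R")
  proof (intro equalityI subsetI)
    fix A assume A: "A \<in> ?L"
    then have fin: "finite A" "A \<noteq> {}" by (auto intro: finite_subset)
    then obtain j where j: "card A = Suc j" by (cases "card A") auto
    have "A \<subseteq> {Min A..m}" "Min A \<in> A" using A fin by auto
    then have "A \<in> ?S (Min A, j)" "(Min A, j) \<in> ?I" using A j by auto
    then show "A \<in> ?R" by blast
  next
    fix A assume "A \<in> ?R"
    then obtain k j where "(k, j) \<in> ?I" "A \<in> ?S (k, j)" by blast
    then show "A \<in> ?L" using Min_eq[of A k] by auto
  qed
  moreover have "card (\<Union>p\<in>?I. ?S p) = (\<Sum>p\<in>?I. card (?S p))"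
  proof (rule card_UN_disjoint)
    show "\<forall>p\<in>?I. finite (?S p)" by auto
    show "\<forall>p\<in>?I. \<forall>q\<in>?I. p \<noteq> q \<longrightarrow> ?S p \<inter> ?S q = {}"
    proof (intro ballI impI)
      fix p q :: "nat \<times> nat" assume pq: "p \<noteq> q"
      have "p = (Min A, card A - 1)" if "A \<in> ?S p" for A p
        using that Min_eq[of A "fst p"] by (cases p) simp
      then show "?S p \<inter> ?S q = {}" using pq by (metis (no_types, lifting) disjoint_iff)
    qed
  qed auto
  ultimately have "int (card ?L) = (\<Sum>(k, j)\<in>?I. int (card (?S (k, j))))"
    by (simp add: case_prod_unfold)
  also have "\<dots> = (\<Sum>k\<le>m. \<Sum>j<b k. int (card (?S (k, j))))"
    by (subst sum.Sigma) auto
  also have "\<dots> = (\<Sum>k\<le>m. \<Sum>j<b k. (Q ^ j) $ (m - k))"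
    by (intro sum.cong refl) (simp add: card_subsets_with_ends)
  finally show ?thesis using assms by (simp add: nth_gf)
qed

text \<open>A strictly increasing enumeration \<open>e\<close> maps \<open>Min A\<close> to the minimum of the image, so it carries the
  Schreier condition over to the condition \<open>card A \<le> e (Min A)\<close> on index sets.\<close>

lemma card_schreier_image_eq_nth_gf:
  assumes e: "strict_mono e" "0 < e 0" and "m < N"
  shows "int (card {F. F \<subseteq> e ` {..m} \<and> e m \<in> F \<and> schreier F}) = gf e N $ m"
proof -
  let ?L = "{F. F \<subseteq> e ` {..m} \<and> e m \<in> F \<and> schreier F}"
  let ?R = "{A. A \<subseteq> {..m} \<and> m \<in> A \<and> card A \<le> e (Min A)}"
  have inj: "inj e" using e(1) by (simp add: strict_mono_imp_inj_on)
  have schreier_iff: "schreier (e ` A) \<longleftrightarrow> card A \<le> e (Min A)" if "A \<subseteq> {..m}" "m \<in> A" for A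
  proof -
    have fin: "finite A" "A \<noteq> {}" using that by (auto intro: finite_subset)
    have "Min (e ` A) = e (Min A)"
      using mono_Min_commute[OF strict_mono_mono[OF e(1)] fin] by simp
    moreover have "card (e ` A) = card A" by (meson card_image inj inj_on_subset subset_UNIV)
    moreover have "0 < e k" for k using e strict_mono_less_eq[OF e(1), of 0 k] by simp
    ultimately show ?thesis using fin by (auto simp: schreier_def)
  qed
  have "?L = (`) e ` ?R"
  proof (intro equalityI subsetI)
    fix F assume F: "F \<in> ?L"
    then obtain A where A: "A \<subseteq> {..m}" "F = e ` A" by (auto simp: subset_image_iff)
    then have "m \<in> A" using F inj by (auto simp: inj_image_mem_iff)
    then show "F \<in> (`) e ` ?R" using A F schreier_iff[of A] by auto
  next
    fix F assume "F \<in> (`) e ` ?R"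
    then show "F \<in> ?L" using schreier_iff by auto
  qed
  moreover have "card ((`) e ` ?R) = card ?R"
    by (rule card_image) (auto intro!: inj_onI simp: inj_image_eq_iff[OF inj])
  ultimately show ?thesis using card_index_sets_eq_nth_gf[OF assms(3)] by simp
qed

lemma card_D_eq_nth_gf:
  assumes "d \<ge> 1" "m < N"
  shows "int (card (D (Suc d) (Suc m))) = gf (nondiv d) N $ m"
proof -
  have "G (Suc d) (Suc m) = nondiv d ` {..m}"
    unfolding G_def range_nondiv[OF assms(1), symmetric]
      enumerate_range_strict_mono[OF strict_mono_nondiv] lessThan_Suc_atMost ..
  moreover have "(Suc d * Suc m - 1) div (Suc d - 1) = nondiv d m"
    using nondiv_floor[OF assms(1)] by simp
  ultimately have "D (Suc d) (Suc m) = {F. F \<subseteq> nondiv d ` {..m} \<and> nondiv d m \<in> F \<and> schreier F}"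
    unfolding D_def by presburger
  then show ?thesis
    using card_schreier_image_eq_nth_gf[OF strict_mono_nondiv _ assms(2)] by (simp add: nondiv_def)
qed

section \<open>The Fibonacci range\<close>

text \<open>Separating \<open>j = 0\<close> and shifting both \<open>k\<close> and \<open>j\<close> in the remaining terms gives
  \<open>gf Suc (N + 1) = (1 + X + \<dots> + X ^ N) + X * Q * gf Suc N\<close>.  After multiplication by \<open>1 - X\<close> the last
  factor becomes \<open>X ^ 2\<close>, and this is the Fibonacci recursion up to the truncation term \<open>X ^ (N + 1)\<close>.\<close>

lemma nth_gf_Suc_eq_fib: "m < N \<Longrightarrow> gf Suc N $ m = int (fib (Suc m))"
proof (induction N arbitrary: m)
  case 0
  then show ?case by simp
next
  case (Suc N)
  have "gf Suc (Suc N) = (\<Sum>k<Suc N. fps_X ^ k) + (\<Sum>k<Suc N. fps_X ^ k * (\<Sum>j<k. Q ^ Suc j))"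
    unfolding gf_def by (simp add: sum.lessThan_Suc_shift distrib_left sum.distrib
        del: power_Suc sum.lessThan_Suc)
  also have "(\<Sum>k<Suc N. fps_X ^ k * (\<Sum>j<k. Q ^ Suc j)) = fps_X * Q * gf Suc N"
    unfolding gf_def
    by (subst sum.lessThan_Suc_shift) (simp add: sum_distrib_left mult_ac del: sum.lessThan_Suc)
  finally have "(1 - fps_X) * gf Suc (Suc N)
      = (1 - fps_X) * (\<Sum>k<Suc N. fps_X ^ k) + fps_X * ((1 - fps_X) * Q) * gf Suc N"
    by (simp add: algebra_simps)
  then have step: "gf Suc (Suc N) - fps_X * gf Suc (Suc N)
      = 1 - fps_X ^ Suc N + fps_X ^ 2 * gf Suc N"
    unfolding one_minus_X_mult_Q one_diff_power_eq[symmetric]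
    by (simp add: left_diff_distrib power2_eq_square)
  have nth: "gf Suc (Suc N) $ i = (if i = 0 then 0 else gf Suc (Suc N) $ (i - 1))
      + (if i = 0 then 1 else 0) - (if i = Suc N then 1 else 0)
      + (if i < 2 then 0 else gf Suc N $ (i - 2))" for i
  proof -
    have "(gf Suc (Suc N) - fps_X * gf Suc (Suc N)) $ i
      = (1 - fps_X ^ Suc N + fps_X ^ 2 * gf Suc N) $ i"
      using step by simp
    then show ?thesis
      by (simp add: fps_X_power_mult_nth del: power_Suc split: if_splits)
  qed
  show ?case
    using Suc.prems
  proof (induction m rule: fib.induct)
    case 1
    show ?case by (subst nth) simp
  next
    case 2
    have "gf Suc (Suc N) $ 0 = 1" by (subst nth) simp
    then show ?case using 2 by (subst nth) simp
  next
    case (3 m)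
    then show ?case using Suc.IH[of m] by (subst nth) simp
  qed
qed

text \<open>The bounds \<open>nondiv d k\<close> and \<open>k + 1\<close> differ only for \<open>k \<ge> d\<close>, and the additional terms have
  \<open>j > k\<close>; they therefore start at degree \<open>k + j > 2 * d \<ge> m\<close>.\<close>

lemma nth_gf_nondiv_eq_fib:
  assumes "d \<ge> 1" "m < 2 * d + 1" "m < N"
  shows "gf (nondiv d) N $ m = int (fib (Suc m))"
proof -
  have "(\<Sum>j<nondiv d k. (Q ^ j) $ (m - k)) = (\<Sum>j<Suc k. (Q ^ j) $ (m - k))" if "k \<le> m" for k
  proof (rule sum.mono_neutral_right)
    show "\<forall>j\<in>{..<nondiv d k} - {..<Suc k}. (Q ^ j) $ (m - k) = 0"
    proof
      fix j assume j: "j \<in> {..<nondiv d k} - {..<Suc k}"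
      then have "k < j" "k div d \<noteq> 0" by (auto simp: nondiv_def)
      then have "d \<le> k" by (metis div_less not_le)
      then have "m < k + j" using \<open>k < j\<close> assms(2) by linarith
      then show "(Q ^ j) $ (m - k) = 0"
        using nth_X_mult_Q_power_eq_0[of m k j] that by (simp add: fps_X_power_mult_nth)
    qed
  qed (auto simp: nondiv_def)
  then have "gf (nondiv d) N $ m = gf Suc N $ m"
    using assms(3) by (simp add: nth_gf)
  then show ?thesis using assms(3) by (simp add: nth_gf_Suc_eq_fib)
qed

section \<open>The linear recurrence\<close>

lemma nth_one_minus_X_power: "((1 - fps_X :: int fps) ^ a) $ i = (-1) ^ i * int (a choose i)"
proof (induction a arbitrary: i)
  case 0
  show ?case by (cases i) simp_all
next
  case (Suc a)
  have "((1 - fps_X :: int fps) ^ Suc a) $ i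
      = ((1 - fps_X) ^ a) $ i - (if i = 0 then 0 else ((1 - fps_X) ^ a) $ (i - 1))"
    by (simp add: left_diff_distrib)
  then show ?case unfolding Suc by (cases i) (simp_all add: distrib_left)
qed

lemma nth_X_mult_one_minus_X_power_eq_0:
  "p + a < i \<Longrightarrow> (fps_X ^ p * (1 - fps_X :: int fps) ^ a) $ i = 0"
  by (simp add: fps_X_power_mult_nth nth_one_minus_X_power)

lemma one_minus_X_power_mult_Q_power:
  assumes "j \<le> a"
  shows "(1 - fps_X) ^ a * Q ^ j = fps_X ^ j * (1 - fps_X) ^ (a - j)"
proof -
  have "(1 - fps_X :: int fps) ^ a = (1 - fps_X) ^ (a - j) * (1 - fps_X) ^ j"
    using assms by (simp flip: power_add)
  then have "(1 - fps_X) ^ a * Q ^ j = (1 - fps_X) ^ (a - j) * ((1 - fps_X) ^ j * Q ^ j)"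
    by (simp only: mult.assoc)
  then show ?thesis unfolding Q_power_cancel by (simp only: mult.commute)
qed

lemma sum_lessThan_add:
  fixes f :: "nat \<Rightarrow> 'a :: comm_monoid_add"
  shows "(\<Sum>k<a + b. f k) = (\<Sum>k<a. f k) + (\<Sum>k<b. f (a + k))"
  by (induction b) (simp_all add: add.assoc)

text \<open>The three summands are the indices \<open>k < d\<close>, then the exponents \<open>j < d + 1\<close> at the indices \<open>k \<ge> d\<close>,
  and finally the exponents \<open>j \<ge> d + 1\<close> at these indices, where cancelling \<open>Q ^ (d + 1)\<close> gives a
  shifted copy of the series.\<close>

lemma gf_nondiv_functional_equation:
  assumes "d \<ge> 1"
  shows "(1 - fps_X) ^ Suc d * gf (nondiv d) (d + M)
    = (\<Sum>k<d. \<Sum>j<Suc k. fps_X ^ (k + j) * (1 - fps_X) ^ (Suc d - j))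
      + (fps_X ^ d - fps_X ^ (d + M)) * (\<Sum>j<Suc d. fps_X ^ j * (1 - fps_X) ^ (d - j))
      + fps_X ^ (2 * d + 1) * gf (nondiv d) M"
proof -
  define Y where "Y = (1 - fps_X :: int fps)"
  define P where "P = (\<Sum>j<Suc d. fps_X ^ j * Y ^ (d - j))"
  define S where "S k = (\<Sum>j<nondiv d k. Q ^ j)" for k
  note cancel = one_minus_X_power_mult_Q_power[folded Y_def]
  \<comment> \<open>For \<open>k < d\<close> the bound is \<open>k + 1 \<le> d\<close>, so every power of \<open>Q\<close> is cancelled by \<open>Y ^ (d + 1)\<close>.\<close>
  have head: "Y ^ Suc d * (fps_X ^ k * S k) = (\<Sum>j<Suc k. fps_X ^ (k + j) * Y ^ (Suc d - j))"
    if "k < d" for k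
  proof -
    have "Y ^ Suc d * (fps_X ^ k * S k) = (\<Sum>j<Suc k. fps_X ^ k * (Y ^ Suc d * Q ^ j))"
      using that by (simp add: S_def nondiv_def sum_distrib_left mult.left_commute
          del: power_Suc sum.lessThan_Suc)
    also have "\<dots> = (\<Sum>j<Suc k. fps_X ^ (k + j) * Y ^ (Suc d - j))"
      by (rule sum.cong) (use that in \<open>simp_all add: cancel power_add mult.assoc del: power_Suc\<close>)
    finally show ?thesis .
  qed
  \<comment> \<open>The first \<open>d + 1\<close> exponents give the same polynomial \<open>Y * P\<close> for every \<open>k\<close>; the others, shifted
    by \<open>d + 1\<close>, give the sum that belongs to the index \<open>k\<close>.\<close>
  have tail: "Y ^ Suc d * S (d + k) = Y * P + fps_X ^ Suc d * S k" for k
  proof -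
    have "nondiv d (d + k) = Suc d + nondiv d k"
      using nondiv_shift[OF assms, of k] by (simp add: add.commute)
    then have split: "S (d + k) = (\<Sum>j<Suc d. Q ^ j) + Q ^ Suc d * S k"
      unfolding S_def by (simp only: sum_lessThan_add sum_distrib_left power_add)
    have "Y ^ Suc d * Q ^ j = Y * (fps_X ^ j * Y ^ (d - j))" if "j < Suc d" for j
    proof -
      have "Y ^ Suc d * Q ^ j = fps_X ^ j * Y ^ Suc (d - j)"
        using that by (simp add: cancel Suc_diff_le del: power_Suc)
      then show ?thesis by (simp add: mult.left_commute)
    qed
    then have "Y ^ Suc d * (\<Sum>j<Suc d. Q ^ j) = Y * P"
      by (simp add: P_def sum_distrib_left del: power_Suc sum.lessThan_Suc)
    moreover have "Y ^ Suc d * (Q ^ Suc d * S k) = fps_X ^ Suc d * S k"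
      using Q_power_cancel[of "Suc d", folded Y_def] by (simp only: mult.assoc[symmetric])
    ultimately show ?thesis unfolding split distrib_left by (simp only:)
  qed
  have "gf (nondiv d) (d + M) = (\<Sum>k<d. fps_X ^ k * S k) + (\<Sum>k<M. fps_X ^ (d + k) * S (d + k))"
    unfolding gf_def S_def[symmetric] by (rule sum_lessThan_add)
  then have "Y ^ Suc d * gf (nondiv d) (d + M)
      = (\<Sum>k<d. Y ^ Suc d * (fps_X ^ k * S k)) + (\<Sum>k<M. fps_X ^ (d + k) * (Y ^ Suc d * S (d + k)))"
    by (simp add: distrib_left sum_distrib_left mult.left_commute del: power_Suc)
  also have "(\<Sum>k<d. Y ^ Suc d * (fps_X ^ k * S k))
      = (\<Sum>k<d. \<Sum>j<Suc k. fps_X ^ (k + j) * Y ^ (Suc d - j))"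
    by (intro sum.cong refl head) simp
  also have "(\<Sum>k<M. fps_X ^ (d + k) * (Y ^ Suc d * S (d + k)))
      = fps_X ^ d * (Y * (\<Sum>k<M. fps_X ^ k)) * P + fps_X ^ d * fps_X ^ Suc d * gf (nondiv d) M"
    unfolding tail gf_def S_def[symmetric]
    by (simp add: distrib_left sum.distrib sum_distrib_left sum_distrib_right power_add mult_ac)
  \<comment> \<open>The factor \<open>Y\<close> left over from \<open>Y * P\<close> collapses the geometric sum over \<open>k\<close>.\<close>
  also have "Y * (\<Sum>k<M. fps_X ^ k) = 1 - fps_X ^ M"
    unfolding Y_def by (rule one_diff_power_eq[symmetric])
  also have "fps_X ^ d * (1 - fps_X ^ M :: int fps) = fps_X ^ d - fps_X ^ (d + M)"
    by (simp add: right_diff_distrib power_add)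
  also have "fps_X ^ d * fps_X ^ Suc d = (fps_X ^ (2 * d + 1) :: int fps)"
    by (simp add: mult_2 power_add[symmetric] del: power_Suc)
  finally show ?thesis unfolding Y_def P_def by (simp only: add.assoc)
qed

text \<open>The first summand of the functional equation has degree at most \<open>2 * d\<close>, and so has the part of the
  second with \<open>X ^ d\<close>; its other part, with \<open>X ^ (m + 1)\<close>, only reflects the truncation and starts
  above \<open>X ^ m\<close>.\<close>

lemma nth_one_minus_X_power_mult_gf_nondiv:
  assumes "d \<ge> 1" "2 * d + 1 \<le> m"
  shows "((1 - fps_X) ^ Suc d * gf (nondiv d) (Suc m)) $ m = gf (nondiv d) (Suc m - d) $ (m - (2 * d + 1))"
proof -
  let ?Y = "1 - fps_X :: int fps"
  have "(\<Sum>k<d. \<Sum>j<Suc k. fps_X ^ (k + j) * ?Y ^ (Suc d - j)) $ m = 0"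
    unfolding fps_sum_nth
    by (intro sum.neutral ballI nth_X_mult_one_minus_X_power_eq_0) (use assms in auto)
  moreover have "((fps_X ^ d - fps_X ^ Suc m) * (\<Sum>j<Suc d. fps_X ^ j * ?Y ^ (d - j))) $ m = 0"
  proof -
    have "(fps_X ^ d * (\<Sum>j<Suc d. fps_X ^ j * ?Y ^ (d - j))) $ m = 0"
      unfolding sum_distrib_left fps_sum_nth mult.assoc[symmetric] power_add[symmetric]
      by (intro sum.neutral ballI nth_X_mult_one_minus_X_power_eq_0) (use assms in auto)
    moreover have "(fps_X ^ Suc m * (\<Sum>j<Suc d. fps_X ^ j * ?Y ^ (d - j))) $ m = 0"
      by (subst fps_X_power_mult_nth) simp
    ultimately show ?thesis by (simp only: left_diff_distrib fps_sub_nth)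
  qed
  moreover have "(fps_X ^ (2 * d + 1) * gf (nondiv d) (Suc m - d)) $ m
      = gf (nondiv d) (Suc m - d) $ (m - (2 * d + 1))"
    using assms(2) by (subst fps_X_power_mult_nth) simp
  moreover have "d + (Suc m - d) = Suc m" using assms(2) by simp
  ultimately show ?thesis
    using gf_nondiv_functional_equation[OF assms(1), of "Suc m - d"] by (simp only: fps_add_nth)
qed

lemma card_D_recurrence:
  assumes d: "d \<ge> 1" and m: "2 * d + 1 \<le> m"
  shows "(\<Sum>i\<le>Suc d. (-1) ^ i * int (Suc d choose i) * int (card (D (Suc d) (Suc m - i))))
    = int (card (D (Suc d) (m - 2 * d)))"
proof -
  have card_eq: "int (card (D (Suc d) (Suc m - i))) = gf (nondiv d) (Suc m) $ (m - i)" if "i \<le> Suc d" for i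
    using card_D_eq_nth_gf[OF d, of "m - i" "Suc m"] that m by (simp add: Suc_diff_le)
  have "((1 - fps_X) ^ Suc d * gf (nondiv d) (Suc m)) $ m
      = (\<Sum>i=0..m. (-1) ^ i * int (Suc d choose i) * gf (nondiv d) (Suc m) $ (m - i))"
    unfolding fps_mult_nth nth_one_minus_X_power ..
  also have "\<dots> = (\<Sum>i\<le>Suc d. (-1) ^ i * int (Suc d choose i) * gf (nondiv d) (Suc m) $ (m - i))"
    by (rule sum.mono_neutral_right) (use m in \<open>auto simp: binomial_eq_0\<close>)
  also have "\<dots> = (\<Sum>i\<le>Suc d. (-1) ^ i * int (Suc d choose i) * int (card (D (Suc d) (Suc m - i))))"
    by (intro sum.cong refl) (simp only: card_eq atMost_iff)
  finally have "(\<Sum>i\<le>Suc d. (-1) ^ i * int (Suc d choose i) * int (card (D (Suc d) (Suc m - i))))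
      = gf (nondiv d) (Suc m - d) $ (m - (2 * d + 1))"
    using nth_one_minus_X_power_mult_gf_nondiv[OF d m] by simp
  also have "\<dots> = int (card (D (Suc d) (Suc (m - (2 * d + 1)))))"
    by (rule card_D_eq_nth_gf[OF d, symmetric]) (use m in simp)
  also have "Suc (m - (2 * d + 1)) = m - 2 * d" using m by simp
  finally show ?thesis .
qed

theorem theorem1p6:
  fixes u :: nat
  assumes "u \<ge> 2"
  shows "(\<forall>n. 1 \<le> n \<and> n \<le> 2 * u - 1 \<longrightarrow> card (D u n) = fib n) \<and>
    (\<forall>n \<ge> 2 * u. int (card (D u n)) =
      (\<Sum>i = 1..u. (-1) ^ (i - 1) * int (u choose i) * int (card (D u (n - i))))
      + int (card (D u (n - 2 * u + 1))))"
proof (intro conjI allI impI)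
  obtain d where u: "u = Suc d" and d: "d \<ge> 1"
    using assms by (cases u) auto
  {
    fix n assume n: "1 \<le> n \<and> n \<le> 2 * u - 1"
    then obtain m where m: "n = Suc m" by (cases n) auto
    have "int (card (D u n)) = int (fib n)"
      using card_D_eq_nth_gf[OF d, of m "Suc m"] nth_gf_nondiv_eq_fib[OF d, of m "Suc m"] n
      by (simp add: u m del: fib.simps)
    then show "card (D u n) = fib n" by simp
  next
    fix n assume n: "2 * u \<le> n"
    then obtain m where m: "n = Suc m" using assms by (cases n) auto
    let ?c = "\<lambda>i. int (u choose i) * int (card (D u (n - i)))"
    have "(\<Sum>i\<le>u. (-1) ^ i * ?c i) = int (card (D u (n - 2 * u + 1)))"
      using card_D_recurrence[OF d, of m] n unfolding u m
      by (simp add: mult.assoc Suc_diff_Suc del: sum.atMost_Suc binomial_Suc_Suc)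
    moreover have "(\<Sum>i\<le>u. (-1) ^ i * ?c i) = ?c 0 + (\<Sum>i = 1..u. (-1) ^ i * ?c i)"
      by (simp add: atMost_atLeast0 sum.atLeast_Suc_atMost)
    moreover have "(\<Sum>i = 1..u. (-1) ^ i * ?c i) = - (\<Sum>i = 1..u. (-1) ^ (i - 1) * ?c i)"
      unfolding sum_negf[symmetric] by (intro sum.cong refl) (auto simp: power_eq_if)
    ultimately show "int (card (D u n)) =
      (\<Sum>i = 1..u. (-1) ^ (i - 1) * int (u choose i) * int (card (D u (n - i))))
      + int (card (D u (n - 2 * u + 1)))"
      by (simp add: mult.assoc)
  }
qed

end
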